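(* Let $N_s\ge 4$ be an even integer, let $C_{N_s}$ be the cycle graph on vertex set $\{1,\dots,N_s\}$, and let $A_{\mathrm{half}}=\{1,\dots,N_s/2\}$, $A_{\mathrm{odd}}=\{1,3,5,\dots,N_s-1\}$ and $A_{\mathrm{even}}=\{2,4,\dots,N_s\}$. Then there is no automorphism $\pi$ of $C_{N_s}$ with $\pi(A_{\mathrm{half}})=A_{\mathrm{odd}}$ or $\pi(A_{\mathrm{half}})=A_{\mathrm{even}}$.
   Context: The cycle graph $C_{N_s}$ has edges $\{i,i+1\}$ for $i=1,\dots,N_s$, with indices modulo $N_s$. An automorphism is a permutation of the vertices that preserves adjacency. *)

theory Defs
  imports "Graph_Theory.Pair_Digraph" "HOL-Combinatorics.Permutations"
begin

text \<open>
  As in \<^theory>\<open>Graph_Theory.Pair_Digraph\<close>, an undirected graph is a symmetric pair digraph: each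
  edge is present as two opposite arcs. The cyclic successor of a vertex \<open>i\<close> of \<open>{1..n}\<close> is
  \<open>i mod n + 1\<close>, since the vertices are numbered from 1 rather than from 0.
\<close>

definition cycle_graph :: "nat \<Rightarrow> nat pair_pre_digraph" where
  "cycle_graph n =
    \<lparr> pverts = {1..n},
      parcs = (\<Union>i\<in>{1..n}. {(i, i mod n + 1), (i mod n + 1, i)}) \<rparr>"

definition graph_automorphism :: "'a pair_pre_digraph \<Rightarrow> ('a \<Rightarrow> 'a) \<Rightarrow> bool" where
  "graph_automorphism G \<pi> \<longleftrightarrow>
    \<pi> permutes pverts G \<and>
    (\<forall>u\<in>pverts G. \<forall>v\<in>pverts G. (\<pi> u, \<pi> v) \<in> parcs G \<longleftrightarrow> (u, v) \<in> parcs G)"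

definition A_half :: "nat \<Rightarrow> nat set" where
  "A_half n = {1..n div 2}"

definition A_odd :: "nat \<Rightarrow> nat set" where
  "A_odd n = {i \<in> {1..n}. odd i}"

definition A_even :: "nat \<Rightarrow> nat set" where
  "A_even n = {i \<in> {1..n}. even i}"

lemma pair_graph_cycle_graph:
  assumes "n \<ge> 3"
  shows "pair_graph (cycle_graph n)"
proof -
  have succ: "i mod n + 1 \<le> n" "i mod n + 1 \<noteq> i" if "1 \<le> i" "i \<le> n" for i
    using assms that by (cases "i = n"; simp)+
  have "sym (parcs (cycle_graph n))"
    by (auto simp: cycle_graph_def sym_def)
  then have "symmetric (with_proj (cycle_graph n))"
    by (simp add: symmetric_def)
  moreover have "fst e \<in> {1..n} \<and> snd e \<in> {1..n} \<and> fst e \<noteq> snd e"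
    if "e \<in> parcs (cycle_graph n)" for e
  proof -
    from that have "\<exists>i\<in>{1..n}. e = (i, i mod n + 1) \<or> e = (i mod n + 1, i)"
      by (simp add: cycle_graph_def)
    then obtain i where i: "1 \<le> i" "i \<le> n"
      and e: "e = (i, i mod n + 1) \<or> e = (i mod n + 1, i)"
      unfolding Bex_def atLeastAtMost_iff by (elim exE conjE)
    from e show ?thesis
      using i succ(1)[OF i] succ(2)[OF i] by (elim disjE) simp_all
  qed
  moreover have "finite (parcs (cycle_graph n))"
    by (simp add: cycle_graph_def)
  moreover have "pverts (cycle_graph n) = {1..n}"
    by (simp add: cycle_graph_def)
  ultimately show ?thesis
    by unfold_locales simp_all
qed

text \<open>On a finite graph it suffices that a permutation maps adjacent vertices to adjacent ones.\<close>

lemma graph_automorphism_iff_finite: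
  assumes "pair_fin_digraph G"
  shows "graph_automorphism G \<pi> \<longleftrightarrow>
    \<pi> permutes pverts G \<and> (\<forall>(u, v)\<in>parcs G. (\<pi> u, \<pi> v) \<in> parcs G)"
proof -
  interpret pair_fin_digraph G by fact
  have wf: "u \<in> pverts G \<and> v \<in> pverts G" if "(u, v) \<in> parcs G" for u v
    using arc_fst_in_verts[OF that] arc_snd_in_verts[OF that] by simp
  have reflect: "(u, v) \<in> parcs G"
    if perm: "\<pi> permutes pverts G" and pres: "\<forall>(u, v)\<in>parcs G. (\<pi> u, \<pi> v) \<in> parcs G"
      and uv: "(\<pi> u, \<pi> v) \<in> parcs G" for u v
  proof -
    have inj: "inj (map_prod \<pi> \<pi>)"
      using permutes_inj[OF perm] by (rule prod.inj_map[rotated]) (rule permutes_inj[OF perm])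
    have "map_prod \<pi> \<pi> ` parcs G \<subseteq> parcs G"
      using pres by auto
    then have "map_prod \<pi> \<pi> ` parcs G = parcs G"
      using endo_inj_surj[OF pair_finite_arcs] inj by (meson inj_on_subset subset_UNIV)
    then have "map_prod \<pi> \<pi> (u, v) \<in> map_prod \<pi> \<pi> ` parcs G"
      using uv by simp
    then show ?thesis
      using inj by (simp only: inj_image_mem_iff)
  qed
  show ?thesis
  proof
    assume "graph_automorphism G \<pi>"
    then show "\<pi> permutes pverts G \<and> (\<forall>(u, v)\<in>parcs G. (\<pi> u, \<pi> v) \<in> parcs G)"
      unfolding graph_automorphism_def using wf by blast
  next
    assume *: "\<pi> permutes pverts G \<and> (\<forall>(u, v)\<in>parcs G. (\<pi> u, \<pi> v) \<in> parcs G)"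
    have "(\<pi> u, \<pi> v) \<in> parcs G \<longleftrightarrow> (u, v) \<in> parcs G" for u v
    proof
      show "(\<pi> u, \<pi> v) \<in> parcs G \<Longrightarrow> (u, v) \<in> parcs G"
        using reflect * by (elim conjE)
      show "(u, v) \<in> parcs G \<Longrightarrow> (\<pi> u, \<pi> v) \<in> parcs G"
        using * by (elim conjE) (drule (1) bspec, simp only: prod.case)
    qed
    then show "graph_automorphism G \<pi>"
      unfolding graph_automorphism_def using conjunct1[OF *] by simp
  qed
qed

end

(* In an even cycle every edge joins an odd to an even vertex, while 1 and 2 are adjacent
   vertices of A_half: their images are adjacent, so they cannot have the same parity. *)
theory Submission
  imports Defs
begin

text \<open>Parity properly 2-colours an even cycle (\<open>cycle_graph_arc_parity\<close>), and
  \<open>A_odd\<close> and \<open>A_even\<close> are its colour classes, hence independent sets. An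
  automorphism sends the edge between 1 and 2 inside \<open>A_half\<close> to an edge inside the
  image, which thus cannot be independent.\<close>

lemma cycle_graph_arc_parity:
  assumes "even n" and "(u, v) \<in> parcs (cycle_graph n)"
  shows "even u \<noteq> even v"
proof -
  obtain i where i: "(u, v) = (i, i mod n + 1) \<or> (u, v) = (i mod n + 1, i)"
    using assms(2) unfolding cycle_graph_def pair_pre_digraph.simps by blast
  \<comment> \<open>Reduction modulo an even number keeps parity, so the wrap-around arc from
    \<open>n\<close> to 1 needs no separate case.\<close>
  have "even (i mod n) \<longleftrightarrow> even i"
    using assms(1) by (rule dvd_mod_iff)
  then have "even (i mod n + 1) \<noteq> even i"
    by simp
  then show ?thesis
    using i by (elim disjE) (simp_all only: prod.inject, blast+)
qed

theorem mainTheorem2: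
  fixes N\<^sub>s :: nat
  assumes "N\<^sub>s \<ge> 4" and "even N\<^sub>s"
  shows "\<not> (\<exists>\<pi>. graph_automorphism (cycle_graph N\<^sub>s) \<pi> \<and>
                (\<pi> ` A_half N\<^sub>s = A_odd N\<^sub>s \<or> \<pi> ` A_half N\<^sub>s = A_even N\<^sub>s))"
proof
  assume "\<exists>\<pi>. graph_automorphism (cycle_graph N\<^sub>s) \<pi> \<and>
                (\<pi> ` A_half N\<^sub>s = A_odd N\<^sub>s \<or> \<pi> ` A_half N\<^sub>s = A_even N\<^sub>s)"
  then obtain \<pi> where aut: "graph_automorphism (cycle_graph N\<^sub>s) \<pi>"
    and img: "\<pi> ` A_half N\<^sub>s = A_odd N\<^sub>s \<or> \<pi> ` A_half N\<^sub>s = A_even N\<^sub>s"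
    by blast
  have "1 \<in> A_half N\<^sub>s" "2 \<in> A_half N\<^sub>s"
    using assms(1) by (auto simp: A_half_def)
  then have "\<pi> 1 \<in> \<pi> ` A_half N\<^sub>s" "\<pi> 2 \<in> \<pi> ` A_half N\<^sub>s"
    by (auto intro: imageI)
  with img have same: "even (\<pi> 1) = even (\<pi> 2)"
    by (auto simp: A_odd_def A_even_def)
  \<comment> \<open>Writing 2 as the cyclic successor of 1 exhibits the arc as the member
    \<open>i = 1\<close> of the union defining \<open>parcs\<close>.\<close>
  have "1 \<in> {1..N\<^sub>s}" "(1, 2) = (1, 1 mod N\<^sub>s + 1)"
    using assms(1) by auto
  then have "(1, 2) \<in> parcs (cycle_graph N\<^sub>s)"
    unfolding cycle_graph_def pair_pre_digraph.simps by blast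
  moreover have "1 \<in> pverts (cycle_graph N\<^sub>s)" "2 \<in> pverts (cycle_graph N\<^sub>s)"
    using assms(1) by (simp_all add: cycle_graph_def)
  ultimately have "(\<pi> 1, \<pi> 2) \<in> parcs (cycle_graph N\<^sub>s)"
    using aut unfolding graph_automorphism_def by blast
  then show False
    using cycle_graph_arc_parity[OF assms(2)] same by blast
qed

end
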